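(* Let $\mathcal{H}_A$ and $\mathcal{H}_B$ be complex Hilbert spaces with $\dim\mathcal{H}_A=r\ge 2$ and $\dim\mathcal{H}_B=s\ge 2$ (both finite), and let $\epsilon$ be a real number. Suppose there exists an $\epsilon$-approximate probabilistic masker for all states in $\mathbb{P}(\mathcal{H}_A)$, i.e. there exist a unit vector $|b\rangle\in\mathcal{H}_B$ and an invertible linear operator $L$ on $\mathcal{H}_A\otimes\mathcal{H}_B$ with $L^\dagger L\le I$ such that, writing for each unit vector $|a\rangle\in\mathcal{H}_A$ $$L(|a\rangle\otimes|b\rangle)=p_a|\Psi_a\rangle,\quad p_a>0,\ |\Psi_a\rangle\in\mathcal{H}_A\otimes\mathcal{H}_B\text{ a unit vector},$$ $$\rho_{A|a}=\operatorname{Tr}_B\big(|\Psi_a\rangle\langle\Psi_a|\big),\qquad \rho_{B|a}=\operatorname{Tr}_A\big(|\Psi_a\rangle\langle\Psi_a|\big),$$ one has, for all unit vectors $|a\rangle,|a'\rangle\in\mathcal{H}_A$, $$F(\rho_{A|a},\rho_{A|a'})\ge 1-\epsilon\quad\text{and}\quad F(\rho_{B|a},\rho_{B|a'})\ge 1-\epsilon .$$ Then $$\epsilon\;\ge\;\frac{\sqrt{2}}{72}\left(-1+\sqrt{1+\frac{36}{\min\{r,s\}}}\right).$$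
   Context: $\mathbb{P}(\mathcal{H})$ denotes the set of pure states (unit vectors) of a Hilbert space $\mathcal{H}$. $\operatorname{Tr}_A$ and $\operatorname{Tr}_B$ are the partial traces over $\mathcal{H}_A$ and $\mathcal{H}_B$. For density matrices $P,Q$, the quantum fidelity is $F(P,Q):=\operatorname{Tr}\sqrt{\sqrt{P}\,Q\,\sqrt{P}}$ (no square is taken). An $\epsilon$-approximate probabilistic masker for a set of pure states $|a_k\rangle\in\mathcal{H}_A$ is an invertible linear (trace-decreasing) operation $L$, together with a fixed pure ancilla state $|b\rangle$, mapping $|a_k\rangle|b\rangle$ to $p_k|\Psi_k\rangle$ with $|\Psi_k\rangle$ a unit vector, such that the marginals of the states $|\Psi_k\rangle$ on each of the two subsystems have pairwise fidelity at least $1-\epsilon$. *)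

theory Defs
  imports "HOL-Analysis.Analysis"
begin

text \<open>
  The Hilbert spaces of dimensions \<open>r\<close> and \<open>s\<close> are \<open>complex ^ 'a\<close> and \<open>complex ^ 'b\<close> with
  \<open>r = CARD('a)\<close> and \<open>s = CARD('b)\<close>; their tensor product is \<open>complex ^ ('a \<times> 'b)\<close>, and
  operators are given by their matrices in the standard bases.  The library norm on
  \<open>complex ^ 'n\<close> is the Hilbert space norm.
\<close>

definition pure_states :: "(complex ^ 'n) set" where
  "pure_states = {v. norm v = 1}"

definition tensor :: "complex ^ 'a::finite \<Rightarrow> complex ^ 'b::finite \<Rightarrow> complex ^ ('a \<times> 'b)" (infixr "\<otimes>" 75) where
  "u \<otimes> v = (\<chi> k. u $ fst k * v $ snd k)"

text \<open>The inner product is conjugate-linear in the first argument.\<close>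

definition cinner :: "complex ^ 'n \<Rightarrow> complex ^ 'n \<Rightarrow> complex" where
  "cinner u v = (\<Sum>i\<in>UNIV. cnj (u $ i) * v $ i)"

definition dagger :: "complex ^ 'n ^ 'm \<Rightarrow> complex ^ 'm ^ 'n" where
  "dagger M = (\<chi> i j. cnj (M $ j $ i))"

definition proj :: "complex ^ 'n \<Rightarrow> complex ^ 'n ^ 'n" where
  "proj v = (\<chi> i j. v $ i * cnj (v $ j))"

definition psd :: "complex ^ 'n ^ 'n \<Rightarrow> bool" where
  "psd M \<longleftrightarrow> dagger M = M \<and> (\<forall>x. 0 \<le> Re (cinner x (M *v x)))"

definition loewner_le :: "complex ^ 'n ^ 'n \<Rightarrow> complex ^ 'n ^ 'n \<Rightarrow> bool" where
  "loewner_le M N \<longleftrightarrow> psd (N - M)"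

text \<open>Unspecified unless the argument is positive semidefinite.\<close>

definition psd_sqrt :: "complex ^ 'n ^ 'n \<Rightarrow> complex ^ 'n ^ 'n" where
  "psd_sqrt M = (THE R. psd R \<and> R ** R = M)"

text \<open>For positive semidefinite arguments the trace below is real, so taking \<open>Re\<close> only
  changes its type.\<close>

definition fidelity :: "complex ^ 'n ^ 'n \<Rightarrow> complex ^ 'n ^ 'n \<Rightarrow> real" where
  "fidelity P Q = Re (trace (psd_sqrt (psd_sqrt P ** Q ** psd_sqrt P)))"

definition ptrace_A :: "complex ^ ('a::finite \<times> 'b::finite) ^ ('a \<times> 'b) \<Rightarrow> complex ^ 'b ^ 'b" where
  "ptrace_A M = (\<chi> j j'. \<Sum>i\<in>UNIV. M $ (i, j) $ (i, j'))"

definition ptrace_B :: "complex ^ ('a::finite \<times> 'b::finite) ^ ('a \<times> 'b) \<Rightarrow> complex ^ 'a ^ 'a" where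
  "ptrace_B M = (\<chi> i i'. \<Sum>j\<in>UNIV. M $ (i, j) $ (i', j))"

definition approx_prob_masker ::
  "real \<Rightarrow> (complex ^ 'a::finite) set \<Rightarrow> complex ^ ('a \<times> 'b::finite) ^ ('a \<times> 'b) \<Rightarrow> complex ^ 'b \<Rightarrow> bool" where
  "approx_prob_masker \<epsilon> S L b \<longleftrightarrow>
     b \<in> pure_states \<and> invertible L \<and> loewner_le (dagger L ** L) (mat 1) \<and>
     (\<exists>(p :: complex ^ 'a \<Rightarrow> real) (\<Psi> :: complex ^ 'a \<Rightarrow> complex ^ ('a \<times> 'b)).
        (\<forall>a\<in>S. 0 < p a \<and> \<Psi> a \<in> pure_states \<and> L *v (a \<otimes> b) = p a *\<^sub>R \<Psi> a) \<and>
        (\<forall>a\<in>S. \<forall>a'\<in>S.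
           fidelity (ptrace_B (proj (\<Psi> a))) (ptrace_B (proj (\<Psi> a'))) \<ge> 1 - \<epsilon> \<and>
           fidelity (ptrace_A (proj (\<Psi> a))) (ptrace_A (proj (\<Psi> a'))) \<ge> 1 - \<epsilon>))"

end

theory Submission
  imports Defs
begin

text \<open>
  Identify a vector of the tensor product with its coefficient matrix \<open>M\<close>, so that its marginals
  are \<open>M M\<^sup>\<dagger>\<close> and, up to a transpose, \<open>M\<^sup>\<dagger> M\<close>.  The fidelity of \<open>M M\<^sup>\<dagger>\<close> and \<open>N N\<^sup>\<dagger>\<close> is
  \<open>Re Tr (N\<^sup>\<dagger> M W)\<close> for some contraction \<open>W\<close>; hence a fidelity at least \<open>f\<close> forces
  \<open>Re Tr (Z\<^sup>\<dagger> (M M\<^sup>\<dagger> - N N\<^sup>\<dagger>)) \<le> (1 - f\<^sup>2) + 2 sqrt (1 - f\<^sup>2)\<close> for all contractions \<open>Z\<close>.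

  The masked states fill the unit sphere of a subspace of dimension at least 2.  For an orthonormal
  pair \<open>A, B\<close> in it, \<open>X = A B\<^sup>\<dagger>\<close> is half the sum of the difference of the first marginals of
  \<open>(A \<plusminus> B) / sqrt 2\<close> and of \<open>\<i>\<close> times that of \<open>(A \<plusminus> \<i> B) / sqrt 2\<close>.  So \<open>Re Tr (Z\<^sup>\<dagger> X)\<close> is small for
  every contraction \<open>Z\<close>.  But the fidelity of the second marginals of \<open>A\<close> and \<open>B\<close> is a number of
  this form.  This yields \<open>\<epsilon> > 7/100\<close> in all dimensions, which exceeds the claimed bound already
  for \<open>min {r, s} = 2\<close>.
\<close>

section \<open>Complex inner products and adjoints\<close>

lemma inner_eq_Re_cinner: "inner x y = Re (cinner x y)" for x y :: "complex ^ 'n"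
  by (simp add: inner_vec_def cinner_def inner_complex_def Re_sum)

lemma cinner_self: "cinner x x = complex_of_real ((norm x)\<^sup>2)" for x :: "complex ^ 'n"
proof -
  have "Im (cinner x x) = 0"
    by (simp add: cinner_def)
  moreover have "Re (cinner x x) = (norm x)\<^sup>2"
    by (simp flip: inner_eq_Re_cinner add: power2_norm_eq_inner)
  ultimately show ?thesis
    by (simp add: complex_eq_iff)
qed

lemma cinner_add_left: "cinner (x + y) z = cinner x z + cinner y z"
  by (simp add: cinner_def algebra_simps sum.distrib)

lemma cinner_add_right: "cinner x (y + z) = cinner x y + cinner x z"
  by (simp add: cinner_def algebra_simps sum.distrib)

lemma cinner_diff_left: "cinner (x - y) z = cinner x z - cinner y z"
  by (simp add: cinner_def algebra_simps sum_subtractf)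

lemma cinner_diff_right: "cinner x (y - z) = cinner x y - cinner x z"
  by (simp add: cinner_def algebra_simps sum_subtractf)

lemma cinner_scale_left: "cinner (c *s x) y = cnj c * cinner x y"
  by (simp add: cinner_def algebra_simps sum_distrib_left)

lemma cinner_scale_right: "cinner x (c *s y) = c * cinner x y"
  by (simp add: cinner_def algebra_simps sum_distrib_left)

lemma cinner_sum_right: "cinner x (\<Sum>e\<in>B. f e) = (\<Sum>e\<in>B. cinner x (f e))"
  by (induction B rule: infinite_finite_induct) (auto simp: cinner_add_right, auto simp: cinner_def)

lemma cinner_minus_right: "cinner x (- y) = - cinner x y"
  by (simp add: cinner_def sum_negf)

lemma cinner_zero [simp]: "cinner 0 x = 0" "cinner x 0 = 0"
  by (simp_all add: cinner_def)

lemma cnj_cinner: "cnj (cinner x y) = cinner y x"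
  by (simp add: cinner_def mult.commute)

lemmas cinner_simps = cinner_add_left cinner_add_right cinner_diff_left cinner_diff_right
  cinner_scale_left cinner_scale_right cinner_sum_right

lemma scaleR_eq_vector_scalar_mult: "t *\<^sub>R x = complex_of_real t *s x" for x :: "complex ^ 'n"
  by (simp add: vec_eq_iff complex_eq_iff)

lemma cinner_matrix_vector: "cinner x (M *v y) = cinner (dagger M *v x) y"
  unfolding cinner_def dagger_def matrix_vector_mult_def
  by (simp add: sum_distrib_left sum_distrib_right algebra_simps) (rule sum.swap)

lemma dagger_dagger [simp]: "dagger (dagger M) = M"
  by (simp add: dagger_def vec_eq_iff)

lemma dagger_mult: "dagger (M ** N) = dagger N ** dagger M"
  by (simp add: dagger_def vec_eq_iff matrix_matrix_mult_def mult.commute)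

lemma dagger_add: "dagger (M + N) = dagger M + dagger N"
  by (simp add: dagger_def vec_eq_iff)

lemma dagger_diff: "dagger (M - N) = dagger M - dagger N"
  by (simp add: dagger_def vec_eq_iff)

lemma dagger_sum: "dagger (\<Sum>e\<in>B. f e) = (\<Sum>e\<in>B. dagger (f e))"
  by (induction B rule: infinite_finite_induct) (auto simp: dagger_add, auto simp: dagger_def vec_eq_iff)

lemma dagger_mat_1 [simp]: "dagger (mat 1) = mat 1"
  by (simp add: dagger_def vec_eq_iff mat_def)

lemma dagger_scaleR: "dagger (t *\<^sub>R M) = t *\<^sub>R dagger M"
  by (simp add: dagger_def vec_eq_iff)

lemma dagger_proj: "dagger (proj e) = proj e"
  by (simp add: dagger_def proj_def vec_eq_iff mult.commute)

lemma proj_mult_vector: "proj e *v x = cinner e x *s e"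
  by (simp add: proj_def cinner_def vec_eq_iff matrix_vector_mult_def sum_distrib_left mult_ac)

lemma sum_matrix_vector_mult: "(\<Sum>e\<in>B. f e) *v x = (\<Sum>e\<in>B. f e *v x)"
  for f :: "'i \<Rightarrow> complex ^ 'n ^ 'm"
  by (induction B rule: infinite_finite_induct) (auto simp: matrix_vector_mult_add_rdistrib)

lemma matrix_vector_mult_sum_right: "M *v (\<Sum>e\<in>B. f e) = (\<Sum>e\<in>B. M *v f e)"
  for M :: "complex ^ 'n ^ 'm"
  by (induction B rule: infinite_finite_induct) (auto simp: matrix_vector_right_distrib)

lemma scaleR_matrix_vector_mult: "(t *\<^sub>R M) *v x = t *\<^sub>R (M *v x)"
  for M :: "complex ^ 'n ^ 'm"
  by (simp add: matrix_vector_mult_def vec_eq_iff scaleR_sum_right)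

section \<open>Spectral theorem and positive square roots\<close>

definition orthonormal :: "(complex ^ 'n) set \<Rightarrow> bool" where
  "orthonormal B \<longleftrightarrow> (\<forall>e\<in>B. \<forall>f\<in>B. cinner e f = (if e = f then 1 else 0))"

text \<open>Complex orthonormality implies orthogonality for the real inner product, so real
  independence applies. The resulting bound is the real dimension, twice the complex one; any finite
  bound lets the maximality argument of the spectral theorem run.\<close>

lemma orthonormal_card_le:
  fixes B :: "(complex ^ 'n) set"
  assumes "orthonormal B"
  shows "finite B" "card B \<le> DIM(complex ^ 'n)"
proof -
  have "independent B"
  proof (rule pairwise_orthogonal_independent)
    show "pairwise orthogonal B"
      using assms by (auto simp: pairwise_def orthogonal_def inner_eq_Re_cinner orthonormal_def)
    show "0 \<notin> B"
      using assms by (force simp: orthonormal_def)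
  qed
  then show "finite B" "card B \<le> DIM(complex ^ 'n)"
    using independent_bound by blast+
qed

lemma continuous_on_cinner [continuous_intros]:
  "continuous_on S f \<Longrightarrow> continuous_on S g \<Longrightarrow> continuous_on S (\<lambda>x. cinner (f x) (g x))"
  unfolding cinner_def by (intro continuous_intros)

lemma continuous_on_matrix_vector_mult [continuous_intros]:
  "continuous_on S f \<Longrightarrow> continuous_on S (\<lambda>x. M *v f x)" for M :: "complex ^ 'n ^ 'm"
  unfolding matrix_vector_mult_def by (intro continuous_intros)

lemma quadratic_nonneg_imp_zero:
  fixes b c :: real
  assumes "\<And>t. 0 \<le> 2 * t * b + t\<^sup>2 * c"
  shows "b = 0"
proof (rule ccontr)
  assume "b \<noteq> 0"
  \<comment> \<open>At \<open>t = - b / k\<close> the form equals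
    \<open>(b / k)\<^sup>2 * (c - 2 * k)\<close>, so any positive \<open>k\<close> with
    \<open>c < 2 * k\<close> will do.\<close>
  define k where "k = \<bar>c\<bar> + 1"
  have k: "k > 0" "c < 2 * k" by (auto simp: k_def)
  have "2 * (- b / k) * b + (- b / k)\<^sup>2 * c = (b\<^sup>2 / k\<^sup>2) * (c - 2 * k)"
    using k(1) by (simp add: field_simps power2_eq_square)
  also have "\<dots> < 0"
    using k \<open>b \<noteq> 0\<close> by (intro mult_pos_neg) auto
  finally show False
    using assms[of "- b / k"] by linarith
qed

lemma eigenvector_in_orthogonal_complement:
  fixes P :: "complex ^ 'n ^ 'n"
  assumes P: "dagger P = P"
    and eig: "\<And>e. e \<in> B \<Longrightarrow> P *v e = complex_of_real (l e) *s e"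
    and x: "x \<noteq> 0" "\<And>e. e \<in> B \<Longrightarrow> cinner e x = 0"
  shows "\<exists>u m. norm u = 1 \<and> (\<forall>e\<in>B. cinner e u = 0) \<and> P *v u = complex_of_real m *s u"
proof -
  \<comment> \<open>\<open>u\<close> maximises the Rayleigh quotient on the invariant subspace \<open>V\<close>; since the form \<open>q\<close> is
    nonnegative on \<open>V\<close> and vanishes at \<open>u\<close>, its derivative there vanishes in the direction \<open>w\<close>.\<close>
  define V where "V = {x. \<forall>e\<in>B. cinner e x = 0}"
  have V_eq: "V = (\<Inter>e\<in>B. {x. cinner e x = 0})" by (auto simp: V_def)
  have "closed V"
    unfolding V_eq by (intro closed_INT ballI closed_Collect_eq continuous_intros)
  then have cpt: "compact (V \<inter> sphere 0 1)"
    by (intro closed_Int_compact compact_sphere)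
  have V_scale: "c *s y \<in> V" if "y \<in> V" for c y
    using that by (simp add: V_def cinner_simps)
  have V_add: "y + z \<in> V" "y - z \<in> V" if "y \<in> V" "z \<in> V" for y z
    using that by (simp_all add: V_def cinner_simps)
  have V_P: "P *v y \<in> V" if "y \<in> V" for y
    using that eig by (simp add: V_def cinner_matrix_vector P cinner_simps)
  have xV: "x \<in> V" using x by (simp add: V_def)
  \<comment> \<open>The nonzero \<open>x\<close> makes the compact set nonempty, so the maximum is
    attained.\<close>
  have "(1 / norm x) *\<^sub>R x \<in> V \<inter> sphere 0 1"
    using x(1) V_scale[OF xV, of "complex_of_real (1 / norm x)"]
    by (auto simp: scaleR_eq_vector_scalar_mult[symmetric] simp del: of_real_divide)
  then obtain u where u: "u \<in> V \<inter> sphere 0 1"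
      "\<And>y. y \<in> V \<inter> sphere 0 1 \<Longrightarrow> Re (cinner y (P *v y)) \<le> Re (cinner u (P *v u))"
    using continuous_attains_sup[OF cpt, of "\<lambda>y. Re (cinner y (P *v y))"]
    by (force intro!: continuous_intros)
  define m where "m = Re (cinner u (P *v u))"
  define q where "q y = m * (norm y)\<^sup>2 - Re (cinner y (P *v y))" for y
  have nu: "norm u = 1" and uV: "u \<in> V" using u by auto
  have q_nonneg: "q y \<ge> 0" if "y \<in> V" for y
  proof (cases "y = 0")
    case False
    define z where "z = (1 / norm y) *\<^sub>R y"
    have "z \<in> V \<inter> sphere 0 1"
      using False V_scale[OF that, of "complex_of_real (1 / norm y)"]
      by (auto simp: z_def scaleR_eq_vector_scalar_mult[symmetric] simp del: of_real_divide)
    then have "Re (cinner z (P *v z)) \<le> m"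
      using u(2) by (simp add: m_def)
    moreover have y: "y = complex_of_real (norm y) *s z"
      using False by (auto simp: z_def simp flip: scaleR_eq_vector_scalar_mult)
    have "cinner y (P *v y) = complex_of_real ((norm y)\<^sup>2) * cinner z (P *v z)"
      by (subst (1 2) y) (simp add: vector_scalar_commute cinner_simps power2_eq_square)
    ultimately show ?thesis
      by (simp add: q_def mult.commute[of _ "(norm y)\<^sup>2"] mult_left_mono)
  qed (simp add: q_def)
  define w where "w = P *v u - complex_of_real m *s u"
  have wV: "w \<in> V" unfolding w_def by (intro V_add V_P V_scale uV)
  have "0 \<le> 2 * t * (- (norm w)\<^sup>2) + t\<^sup>2 * q w" for t
  proof -
    have "cinner w w = cinner w (P *v u) - m * cinner w u"
      by (subst (2) w_def) (simp add: cinner_simps)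
    then have ww: "(norm w)\<^sup>2 = Re (cinner w (P *v u)) - m * Re (cinner w u)"
      by (metis (no_types, opaque_lifting) Re_complex_of_real cinner_self minus_complex.sel(1) times_complex.sel(1)
          Im_complex_of_real diff_zero mult_zero_left)
    have s1: "Re (cinner u w) = Re (cinner w u)" for u
      by (simp add: inner_commute flip: inner_eq_Re_cinner)
    have s2: "cinner u (P *v w) = cinner (P *v u) w"
      by (simp add: cinner_matrix_vector P)
    have n2: "(norm (u + t *\<^sub>R w))\<^sup>2 = (norm u)\<^sup>2 + 2 * t * Re (cinner w u) + t\<^sup>2 * (norm w)\<^sup>2"
      by (simp add: power2_norm_eq_inner inner_add_left inner_add_right inner_commute[of u w]
          power2_eq_square[of t] algebra_simps flip: inner_eq_Re_cinner)
    have p2: "Re (cinner (u + t *\<^sub>R w) (P *v (u + t *\<^sub>R w)))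
        = m + 2 * t * Re (cinner w (P *v u)) + t\<^sup>2 * Re (cinner w (P *v w))"
      unfolding scaleR_eq_vector_scalar_mult
      by (simp add: matrix_vector_right_distrib vector_scalar_commute cinner_simps m_def
          power2_eq_square algebra_simps s1 s2)
    have "q (u + t *\<^sub>R w) = 2 * t * (- (norm w)\<^sup>2) + t\<^sup>2 * q w"
      unfolding q_def n2 p2 by (simp add: nu ww algebra_simps)
    moreover have "u + t *\<^sub>R w \<in> V"
      using V_add V_scale uV wV by (simp add: scaleR_eq_vector_scalar_mult)
    ultimately show ?thesis using q_nonneg by metis
  qed
  from quadratic_nonneg_imp_zero[OF this] have "w = 0" by simp
  then show ?thesis
    using nu uV by (auto simp: w_def V_def)
qed


lemma orthonormal_insert:
  assumes "orthonormal B" "norm u = 1" "\<forall>e\<in>B. cinner e u = 0"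
  shows "orthonormal (insert u B)"
proof -
  have "cinner u e = 0" if "e \<in> B" for e
    using assms(3) that by (metis cnj_cinner complex_cnj_zero)
  then show ?thesis
    using assms by (auto simp: orthonormal_def cinner_self)
qed

text \<open>Labelling each eigenvalue by its eigenvector lets the basis be an unordered set and
  handles multiplicities. Completeness is stated in the form in which it is used, as the Fourier
  expansion.\<close>

definition eigenbasis :: "complex ^ 'n ^ 'n \<Rightarrow> (complex ^ 'n) set \<Rightarrow> (complex ^ 'n \<Rightarrow> real) \<Rightarrow> bool" where
  "eigenbasis P B l \<longleftrightarrow> finite B \<and> orthonormal B \<and>
     (\<forall>e\<in>B. P *v e = complex_of_real (l e) *s e) \<and> (\<forall>x. x = (\<Sum>e\<in>B. cinner e x *s e))"

text \<open>An orthonormal set of eigenvectors of greatest cardinality has trivial orthogonal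
  complement, since an eigenvector found there would enlarge it.\<close>

lemma spectral_theorem:
  fixes P :: "complex ^ 'n ^ 'n"
  assumes P: "dagger P = P"
  shows "\<exists>B l. eigenbasis P B l"
proof -
  define good where
    "good B \<longleftrightarrow> orthonormal B \<and> (\<forall>e\<in>B. \<exists>m. P *v e = complex_of_real m *s e)" for B
  have "good {}" by (simp add: good_def orthonormal_def)
  moreover have "\<forall>B. good B \<longrightarrow> card B \<le> DIM(complex ^ 'n)"
    using orthonormal_card_le(2) unfolding good_def by blast
  \<comment> \<open>\<open>Suc\<close> turns the bound on the cardinality into a strict one.\<close>
  ultimately obtain B where B: "good B" and max: "\<And>C. good C \<Longrightarrow> card C \<le> card B"
    using ex_has_greatest_nat[of good "{}" card "Suc (DIM(complex ^ 'n))"] by (auto simp: less_Suc_eq_le)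
  from B have orth: "orthonormal B" by (simp add: good_def)
  then have fin: "finite B" by (rule orthonormal_card_le)
  from B obtain l where l: "\<And>e. e \<in> B \<Longrightarrow> P *v e = complex_of_real (l e) *s e"
    unfolding good_def by metis
  have complement: "y = 0" if y: "\<And>e. e \<in> B \<Longrightarrow> cinner e y = 0" for y
  proof (rule ccontr)
    assume "y \<noteq> 0"
    from eigenvector_in_orthogonal_complement[OF P l this y]
    obtain u m where u: "norm u = 1" "\<forall>e\<in>B. cinner e u = 0" "P *v u = complex_of_real m *s u"
      by blast
    have "good (insert u B)"
      using B u orthonormal_insert unfolding good_def by auto
    moreover have "u \<notin> B"
      using u by (auto simp: cinner_self)
    ultimately show False
      using max[of "insert u B"] fin by simp
  qed
  have "x = (\<Sum>e\<in>B. cinner e x *s e)" for x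
  proof -
    have "cinner f (x - (\<Sum>e\<in>B. cinner e x *s e)) = 0" if f: "f \<in> B" for f
    proof -
      have "cinner f (\<Sum>e\<in>B. cinner e x *s e) = (\<Sum>e\<in>B. if e = f then cinner f x else 0)"
        using orth f unfolding cinner_simps orthonormal_def by (intro sum.cong) auto
      also have "\<dots> = cinner f x"
        using fin f by simp
      finally show ?thesis by (simp add: cinner_simps)
    qed
    from complement[OF this] show ?thesis by simp
  qed
  then show ?thesis
    using fin orth l unfolding eigenbasis_def by blast
qed

lemma eigenbasis_matrix_eqI:
  fixes S T :: "complex ^ 'n ^ 'm"
  assumes "eigenbasis P B l" "\<And>e. e \<in> B \<Longrightarrow> S *v e = T *v e"
  shows "S = T"
proof -
  have "S *v x = T *v x" for x
  proof -
    have x: "x = (\<Sum>e\<in>B. cinner e x *s e)"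
      using assms(1) unfolding eigenbasis_def by blast
    show ?thesis
      by (subst (1 2) x) (simp add: matrix_vector_mult_sum_right vector_scalar_commute assms(2))
  qed
  then show ?thesis by (simp add: matrix_eq)
qed

text \<open>\<open>T\<close> is g(P), the sum of \<open>g (l e) *\<^sub>R proj e\<close>. It is used
  with \<open>sqrt\<close> for positive roots and with \<open>inverse\<close> for a
  pseudo-inverse.\<close>

lemma functional_calculus:
  fixes P :: "complex ^ 'n ^ 'n" and g :: "real \<Rightarrow> real"
  assumes P: "eigenbasis P B l"
  shows "\<exists>T. dagger T = T \<and> (\<forall>e\<in>B. T *v e = complex_of_real (g (l e)) *s e) \<and>
    ((\<forall>e\<in>B. g (l e) \<ge> 0) \<longrightarrow> psd T)"
proof -
  define T where "T = (\<Sum>e\<in>B. g (l e) *\<^sub>R proj e)"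
  have T: "T *v x = (\<Sum>e\<in>B. complex_of_real (g (l e)) *s (cinner e x *s e))" for x
    by (simp add: T_def sum_matrix_vector_mult scaleR_matrix_vector_mult proj_mult_vector
        scaleR_eq_vector_scalar_mult)
  have herm: "dagger T = T"
    by (simp add: T_def dagger_sum dagger_scaleR dagger_proj)
  have eig: "T *v f = complex_of_real (g (l f)) *s f" if "f \<in> B" for f
  proof -
    have "T *v f = (\<Sum>e\<in>B. if e = f then complex_of_real (g (l f)) *s f else 0)"
      unfolding T using P that by (intro sum.cong) (auto simp: eigenbasis_def orthonormal_def)
    then show ?thesis
      using P that by (simp add: eigenbasis_def)
  qed
  have "Re (cinner x (T *v x)) \<ge> 0" if "\<forall>e\<in>B. g (l e) \<ge> 0" for x
  proof -
    have "cinner e x * cinner x e = complex_of_real ((cmod (cinner e x))\<^sup>2)" for e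
      by (metis cnj_cinner complex_norm_square)
    then have "cinner x (T *v x) = (\<Sum>e\<in>B. complex_of_real (g (l e) * (cmod (cinner e x))\<^sup>2))"
      by (simp add: T cinner_simps mult.assoc)
    then have "Re (cinner x (T *v x)) = (\<Sum>e\<in>B. g (l e) * (cmod (cinner e x))\<^sup>2)"
      by (simp only: Re_sum Re_complex_of_real)
    also have "\<dots> \<ge> 0"
      using that by (intro sum_nonneg) auto
    finally show ?thesis .
  qed
  then show ?thesis
    using herm eig by (auto simp: psd_def)
qed

section \<open>Existence and uniqueness of the positive square root\<close>

lemma eigenbasis_psd_nonneg:
  assumes "eigenbasis P B l" "psd P" "e \<in> B"
  shows "l e \<ge> 0"
proof -
  have "cinner e (P *v e) = complex_of_real (l e)"
    using assms by (simp add: eigenbasis_def orthonormal_def cinner_simps)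
  then show ?thesis
    using assms(2) unfolding psd_def by (metis Re_complex_of_real)
qed

text \<open>The vector \<open>w\<close> = (R - sqrt m) e is annihilated by R + sqrt m, so R w = -
  sqrt m w. For m > 0 positivity of \<open>R\<close> forces \<open>w = 0\<close>; for m = 0 the
  squared norm of R e is the inner product of e with R R e = 0.\<close>

lemma psd_root_eigenvector:
  assumes R: "psd R" and "R ** R = P" and e: "P *v e = complex_of_real m *s e" and "m \<ge> 0"
  shows "R *v e = complex_of_real (sqrt m) *s e"
proof -
  define w where "w = R *v e - complex_of_real (sqrt m) *s e"
  have RR: "R *v (R *v e) = complex_of_real m *s e"
    using assms by (simp add: matrix_vector_mul_assoc)
  have sm: "complex_of_real (sqrt m) * complex_of_real (sqrt m) = complex_of_real m"
    using \<open>m \<ge> 0\<close> by (simp flip: of_real_mult)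
  have "R *v w = - (complex_of_real (sqrt m) *s w)"
    unfolding w_def by (simp add: matrix_vector_mult_diff_distrib RR vector_scalar_commute
        vector_ssub_ldistrib vector_smult_assoc sm)
  then have Rw: "cinner w (R *v w) = - complex_of_real (sqrt m * (norm w)\<^sup>2)"
    by (simp add: cinner_self cinner_simps cinner_minus_right)
  have "0 \<le> Re (cinner w (R *v w))"
    using R by (simp add: psd_def)
  then have "sqrt m * (norm w)\<^sup>2 \<le> 0"
    unfolding Rw by (simp del: of_real_mult of_real_power)
  moreover have "w = 0" if "m = 0"
  proof -
    have "cinner w w = cinner e (R *v (R *v e))"
      using R that by (simp add: w_def psd_def cinner_matrix_vector)
    then show ?thesis
      using RR that by (simp add: cinner_self)
  qed
  ultimately have "w = 0"
    using \<open>m \<ge> 0\<close> by (cases "m = 0") (auto simp: mult_le_0_iff)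
  then show ?thesis by (simp add: w_def)
qed

text \<open>This gives the description in \<open>psd_sqrt\<close> its meaning. Uniqueness holds
  because the previous lemma prescribes every positive root on an eigenbasis of
  \<open>P\<close>.\<close>

lemma ex1_psd_root:
  assumes "psd P"
  shows "\<exists>!R. psd R \<and> R ** R = P"
proof -
  obtain B l where B: "eigenbasis P B l"
    using spectral_theorem assms unfolding psd_def by blast
  note nonneg = eigenbasis_psd_nonneg[OF B assms]
  obtain T where T: "psd T" "\<And>e. e \<in> B \<Longrightarrow> T *v e = complex_of_real (sqrt (l e)) *s e"
    using functional_calculus[OF B, of sqrt] nonneg by auto
  have "T ** T = P"
  proof (rule eigenbasis_matrix_eqI[OF B])
    fix e assume e: "e \<in> B"
    then have "T ** T *v e = (complex_of_real (sqrt (l e) * sqrt (l e))) *s e"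
      by (simp add: T vector_scalar_commute of_real_mult flip: matrix_vector_mul_assoc
          del: real_sqrt_mult_self)
    then show "T ** T *v e = P *v e"
      using B e nonneg[OF e] by (simp add: eigenbasis_def)
  qed
  moreover have "R = T" if "psd R" "R ** R = P" for R
  proof (rule eigenbasis_matrix_eqI[OF B])
    fix e assume e: "e \<in> B"
    then show "R *v e = T *v e"
      using psd_root_eigenvector[OF that] B nonneg[OF e] T(2) by (simp add: eigenbasis_def)
  qed
  ultimately show ?thesis
    using T(1) by blast
qed

lemma psd_psd_sqrt: "psd P \<Longrightarrow> psd (psd_sqrt P)"
  and psd_sqrt_square: "psd P \<Longrightarrow> psd_sqrt P ** psd_sqrt P = P"
  using theI'[OF ex1_psd_root] unfolding psd_sqrt_def by blast+

section \<open>Contractions and fidelity\<close>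

text \<open>Operator norm at most 1, stated vector by vector because \<open>norm\<close> of a matrix
  is here the Frobenius norm.\<close>

definition contraction :: "complex ^ 'n ^ 'm \<Rightarrow> bool" where
  "contraction W \<longleftrightarrow> (\<forall>x. norm (W *v x) \<le> norm x)"

lemma norm_le_norm_if_square_le:
  "(norm x)\<^sup>2 \<le> norm x * norm y \<Longrightarrow> norm x \<le> norm y"
  by (cases "norm x = 0") (auto simp: power2_eq_square)

lemma contraction_dagger:
  assumes "contraction W"
  shows "contraction (dagger W)"
  unfolding contraction_def
proof
  fix x
  define y where "y = dagger W *v x"
  have "(norm y)\<^sup>2 = inner x (W *v y)"
    using cinner_matrix_vector[of x W y] by (simp add: inner_eq_Re_cinner cinner_self flip: y_def)
  also have "\<dots> \<le> norm x * norm (W *v y)"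
    by (rule norm_cauchy_schwarz)
  also have "\<dots> \<le> norm y * norm x"
    using assms by (simp add: contraction_def mult.commute[of "norm y"] mult_left_mono)
  finally show "norm (dagger W *v x) \<le> norm x"
    using norm_le_norm_if_square_le y_def by blast
qed

lemma contraction_mult: "contraction V \<Longrightarrow> contraction W \<Longrightarrow> contraction (V ** W)"
  unfolding contraction_def by (metis matrix_vector_mul_assoc order_trans)

lemma contraction_mat_i: "contraction (mat \<i> :: complex ^ 'n ^ 'n)"
proof -
  have "(\<Sum>j\<in>UNIV. (if i = j then \<i> else 0) * x $ j) = \<i> * x $ i" for x :: "complex ^ 'n" and i
    by (simp add: if_distrib[of "\<lambda>c. c * _"] cong: if_cong)
  then show ?thesis
    by (simp add: contraction_def norm_vec_def matrix_vector_mult_def mat_def norm_mult)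
qed

text \<open>The transpose is the entrywise conjugate of the adjoint, and conjugating the entries of
  a vector preserves its norm.\<close>

lemma contraction_transpose:
  fixes W :: "complex ^ 'n ^ 'm"
  assumes "contraction W"
  shows "contraction (transpose W)"
  unfolding contraction_def
proof
  fix x :: "complex ^ 'm"
  define y where "y = (\<chi> i. cnj (x $ i))"
  have "(transpose W *v x) $ i = cnj ((dagger W *v y) $ i)" for i
    by (simp add: y_def transpose_def dagger_def matrix_vector_mult_def)
  then have "norm (transpose W *v x) = norm (dagger W *v y)"
    by (simp add: norm_vec_def)
  also have "\<dots> \<le> norm y"
    using contraction_dagger[OF assms] by (simp add: contraction_def)
  also have "norm y = norm x"
    by (simp add: norm_vec_def y_def)
  finally show "norm (transpose W *v x) \<le> norm x" .
qed

text \<open>Polar decomposition with \<open>R\<close> = |K|. The factor is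
  \<open>T ** dagger K\<close>, whose adjoint \<open>K ** T\<close> is a contraction:
  \<open>K\<close> and \<open>R\<close> give vectors of equal norm, and \<open>R ** T\<close> is the
  orthogonal projection onto the range of \<open>R\<close>.\<close>

lemma polar_factor:
  fixes R :: "complex ^ 'n ^ 'n" and K :: "complex ^ 'n ^ 'm"
  assumes R: "psd R" and RK: "R ** R = dagger K ** K"
  shows "\<exists>V. contraction V \<and> R = V ** K"
proof -
  have herm: "dagger R = R" using R by (simp add: psd_def)
  obtain B l where B: "eigenbasis R B l"
    using spectral_theorem[OF herm] by blast
  \<comment> \<open>\<open>T\<close> is the pseudo-inverse of \<open>R\<close>, as \<open>inverse 0 = 0\<close>.\<close>
  obtain T where T: "dagger T = T" "\<And>e. e \<in> B \<Longrightarrow> T *v e = complex_of_real (inverse (l e)) *s e"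
    using functional_calculus[OF B, of inverse] by auto
  have Re: "R *v e = complex_of_real (l e) *s e" if "e \<in> B" for e
    using B that by (simp add: eigenbasis_def)
  have TR: "T ** R = R ** T"
    by (rule eigenbasis_matrix_eqI[OF B])
      (simp add: T Re vector_scalar_commute vector_smult_assoc mult.commute flip: matrix_vector_mul_assoc)
  have TRR: "T ** (R ** R) = R"
  proof (rule eigenbasis_matrix_eqI[OF B])
    fix e assume e: "e \<in> B"
    then show "T ** (R ** R) *v e = R *v e"
      by (cases "l e = 0")
        (simp_all add: T Re vector_scalar_commute vector_smult_assoc flip: matrix_vector_mul_assoc)
  qed
  define p where "p = R ** T"
  have p: "dagger p = p" "p ** p = p"
    using TRR by (simp_all add: p_def dagger_mult T(1) herm TR)
      (metis TR matrix_mul_assoc)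
  have isometric: "norm (K *v x) = norm (R *v x)" for x
  proof -
    have "cinner (K *v x) (K *v x) = cinner (R *v x) (R *v x)"
      by (simp add: cinner_matrix_vector matrix_vector_mul_assoc RK herm)
    then show ?thesis
      by (simp add: cinner_self del: of_real_power)
  qed
  have "contraction p"
    unfolding contraction_def
  proof
    fix x
    have "cinner (p *v x) (p *v x) = cinner (p *v x) x"
      by (simp add: cinner_matrix_vector matrix_vector_mul_assoc p)
    then have "(norm (p *v x))\<^sup>2 = inner (p *v x) x"
      by (simp add: power2_norm_eq_inner inner_eq_Re_cinner)
    also have "\<dots> \<le> norm (p *v x) * norm x"
      by (rule norm_cauchy_schwarz)
    finally show "norm (p *v x) \<le> norm x"
      by (rule norm_le_norm_if_square_le)
  qed
  then have "contraction (K ** T)"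
    unfolding contraction_def p_def by (simp add: isometric flip: matrix_vector_mul_assoc)
  then have "contraction (T ** dagger K)"
    using contraction_dagger[of "K ** T"] by (simp add: dagger_mult T(1))
  moreover have "R = T ** dagger K ** K"
    using TRR RK by (simp flip: matrix_mul_assoc)
  ultimately show ?thesis by blast
qed


section \<open>The Hilbert-Schmidt inner product\<close>

lemma inner_eq_Re_trace: "inner A B = Re (trace (dagger A ** B))" for A B :: "complex ^ 'n ^ 'm"
  unfolding trace_def matrix_matrix_mult_def dagger_def
  by (simp add: inner_vec_def inner_complex_def) (rule sum.swap)

lemma inner_mult_right1: "inner A (B ** C) = inner (dagger B ** A) C"
  for A :: "complex ^ 'n ^ 'm"
  by (simp add: inner_eq_Re_trace dagger_mult matrix_mul_assoc)

lemma inner_mult_right2: "inner A (B ** C) = inner (A ** dagger C) B"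
  for A :: "complex ^ 'n ^ 'm"
  by (simp add: inner_eq_Re_trace dagger_mult matrix_mul_assoc) (metis matrix_mul_assoc trace_mul_sym)

lemma norm_dagger: "norm (dagger A) = norm A" for A :: "complex ^ 'n ^ 'm"
proof -
  have "(norm (dagger A))\<^sup>2 = (norm A)\<^sup>2"
    by (simp add: power2_norm_eq_inner inner_eq_Re_trace trace_mul_sym[of A])
  then show ?thesis by simp
qed

text \<open>\<open>W\<close> acts on each column separately, and the squared Frobenius norm is the
  sum of the squared column norms.\<close>

lemma norm_contraction_mult_left:
  fixes A :: "complex ^ 'n ^ 'm" and W :: "complex ^ 'm ^ 'k"
  assumes "contraction W"
  shows "norm (W ** A) \<le> norm A"
proof -
  have cols: "(norm B)\<^sup>2 = (\<Sum>j\<in>UNIV. (norm (column j B))\<^sup>2)" for B :: "complex ^ 'n ^ 'l"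
    unfolding power2_norm_eq_inner inner_vec_def column_def by simp (rule sum.swap)
  have "column j (W ** A) = W *v column j A" for j
    by (simp add: column_def matrix_matrix_mult_def matrix_vector_mult_def vec_eq_iff)
  then have "(norm (W ** A))\<^sup>2 \<le> (norm A)\<^sup>2"
    using assms by (simp add: cols contraction_def sum_mono power_mono)
  then show ?thesis
    by (simp add: power2_le_iff_abs_le)
qed

lemma norm_contraction_mult_right:
  fixes A :: "complex ^ 'n ^ 'm" and W :: "complex ^ 'k ^ 'n"
  assumes "contraction W"
  shows "norm (A ** W) \<le> norm A"
  using norm_contraction_mult_left[OF contraction_dagger[OF assms], of "dagger A"]
  by (simp add: norm_dagger flip: dagger_mult)

lemma matrix_add_rdistrib: "(A + B) ** C = A ** C + B ** C" for A :: "complex ^ 'n ^ 'm"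
  by (simp add: vec_eq_iff matrix_matrix_mult_def algebra_simps sum.distrib)

lemma matrix_diff_ldistrib: "A ** (B - C) = A ** B - A ** C" for A :: "complex ^ 'n ^ 'm"
  by (simp add: vec_eq_iff matrix_matrix_mult_def algebra_simps sum_subtractf)

lemma matrix_diff_rdistrib: "(A - B) ** C = A ** C - B ** C" for A :: "complex ^ 'n ^ 'm"
  by (simp add: vec_eq_iff matrix_matrix_mult_def algebra_simps sum_subtractf)

lemma psd_mult_dagger: "psd (K ** dagger K)"
proof -
  have "cinner x (K ** dagger K *v x) = cinner (dagger K *v x) (dagger K *v x)" for x
    by (simp add: cinner_matrix_vector[of x K] flip: matrix_vector_mul_assoc)
  then show ?thesis
    by (simp add: psd_def dagger_mult cinner_self)
qed

section \<open>Fidelity and differences of marginals\<close>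

text \<open>The attainment half of Uhlmann's formula. Polar factors give A = U M\<dagger> for the
  root \<open>A\<close> of M M\<dagger>, and R = V N\<dagger> A for the outer root \<open>R\<close>.
  Since \<open>A\<close> is Hermitian, A = M U\<dagger>, and cyclicity of the trace leaves W =
  U\<dagger> V.\<close>

lemma fidelity_eq_inner_contraction:
  fixes M N :: "complex ^ 's ^ 'r"
  shows "\<exists>W. contraction W \<and> fidelity (M ** dagger M) (N ** dagger N) = inner N (M ** W)"
proof -
  define A where "A = psd_sqrt (M ** dagger M)"
  have A: "psd A" "A ** A = M ** dagger M"
    unfolding A_def by (simp_all add: psd_psd_sqrt psd_sqrt_square psd_mult_dagger)
  then have herm: "dagger A = A" by (simp add: psd_def)
  define R where "R = psd_sqrt (A ** (N ** dagger N) ** A)"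
  \<comment> \<open>The form K K\<dagger> shows positivity, so that the outer
    \<open>psd_sqrt\<close> is a genuine root.\<close>
  have eq: "A ** (N ** dagger N) ** A = A ** N ** dagger (A ** N)"
    by (simp add: dagger_mult herm matrix_mul_assoc)
  have R: "psd R" "R ** R = A ** (N ** dagger N) ** A"
    unfolding R_def eq by (simp_all add: psd_psd_sqrt psd_sqrt_square psd_mult_dagger)
  obtain U where U: "contraction U" "A = U ** dagger M"
    using polar_factor[OF A(1), of "dagger M"] A(2) by auto
  obtain V where V: "contraction V" "R = V ** (dagger N ** A)"
    using polar_factor[OF R(1), of "dagger N ** A"] R(2)
    by (auto simp: dagger_mult herm matrix_mul_assoc)
  have "A = M ** dagger U"
    using U(2) herm by (metis dagger_dagger dagger_mult)
  then have "trace R = trace (V ** (dagger N ** M ** dagger U))"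
    using V(2) by (simp add: matrix_mul_assoc)
  also have "\<dots> = trace (dagger N ** (M ** (dagger U ** V)))"
    by (subst trace_mul_sym) (simp add: matrix_mul_assoc)
  finally have "fidelity (M ** dagger M) (N ** dagger N) = inner N (M ** (dagger U ** V))"
    by (simp add: fidelity_def inner_eq_Re_trace flip: A_def R_def)
  moreover have "contraction (dagger U ** V)"
    using U(1) V(1) by (intro contraction_mult contraction_dagger)
  ultimately show ?thesis by blast
qed

text \<open>Pairing with all contractions is dual to the trace norm, so this is the Cauchy-Schwarz
  bound for the trace norm of A B\<dagger>.\<close>

lemma inner_contraction_le:
  fixes A B :: "complex ^ 's ^ 'r"
  assumes "contraction Z"
  shows "inner Z (A ** dagger B) \<le> norm A * norm B"
proof -
  have "inner Z (A ** dagger B) = inner (Z ** B) A"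
    by (simp add: inner_mult_right2)
  also have "\<dots> \<le> norm (Z ** B) * norm A"
    by (rule norm_cauchy_schwarz)
  also have "\<dots> \<le> norm B * norm A"
    by (intro mult_right_mono norm_contraction_mult_left assms) simp
  finally show ?thesis by (simp add: mult.commute)
qed

lemma psd_one_minus_contraction:
  assumes "contraction W"
  shows "psd (mat 1 - W ** dagger W)"
proof -
  have "Re (cinner x ((mat 1 - W ** dagger W) *v x)) = (norm x)\<^sup>2 - (norm (dagger W *v x))\<^sup>2" for x
    by (simp add: matrix_vector_mult_diff_rdistrib cinner_diff_right cinner_self
        cinner_matrix_vector[of x W] flip: matrix_vector_mul_assoc)
  moreover have "norm (dagger W *v x) \<le> norm x" for x
    using contraction_dagger[OF assms] by (simp add: contraction_def)
  ultimately show ?thesis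
    by (simp add: psd_def dagger_diff dagger_mult power_mono)
qed

lemma inner_marginal_difference_le:
  fixes M N :: "complex ^ 's ^ 'r"
  assumes unit: "norm M = 1" "norm N = 1"
    and F: "fidelity (M ** dagger M) (N ** dagger N) \<ge> f" "f \<ge> 0"
    and Z: "contraction Z"
  shows "inner Z (M ** dagger M - N ** dagger N) \<le> (1 - f\<^sup>2) + 2 * sqrt (1 - f\<^sup>2)"
proof -
  obtain W where W: "contraction W" "fidelity (M ** dagger M) (N ** dagger N) = inner N (M ** W)"
    using fidelity_eq_inner_contraction by blast
  \<comment> \<open>The defect operator of \<open>W\<close>: it makes M M\<dagger> - C C\<dagger>
    equal to (M S)(M S)\<dagger>.\<close>
  define S where "S = psd_sqrt (mat 1 - W ** dagger W)"
  have S: "S ** S = mat 1 - W ** dagger W" "dagger S = S"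
    using psd_psd_sqrt psd_sqrt_square psd_one_minus_contraction[OF W(1)]
    unfolding S_def psd_def by blast+
  define C where "C = M ** W"
  define c where "c = (norm C)\<^sup>2"
  have f: "f \<le> inner N C"
    using F W by (simp add: C_def)
  also have "\<dots> \<le> norm C"
    using norm_cauchy_schwarz[of N C] unit by simp
  finally have fc: "f\<^sup>2 \<le> c"
    unfolding c_def using F(2) by (rule power_mono)
  have "norm C \<le> 1"
    using norm_contraction_mult_right[OF W(1), of M] unit by (simp add: C_def)
  then have c1: "c \<le> 1" unfolding c_def by (simp add: power_le_one)
  have MS: "(M ** S) ** dagger (M ** S) = M ** dagger M - C ** dagger C"
  proof -
    have "(M ** S) ** dagger (M ** S) = M ** (S ** S) ** dagger M"
      by (simp add: dagger_mult S(2) matrix_mul_assoc)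
    then show ?thesis
      by (simp add: S(1) C_def dagger_mult matrix_mul_assoc matrix_diff_ldistrib matrix_diff_rdistrib)
  qed
  \<comment> \<open>Pairing with the identity takes the trace.\<close>
  have tr: "inner (mat 1) (A ** dagger A) = (norm A)\<^sup>2" for A :: "complex ^ 's ^ 'r"
    by (simp add: inner_mult_right2 power2_norm_eq_inner)
  have "(norm (M ** S))\<^sup>2 = 1 - c"
    using arg_cong[OF MS, of "inner (mat 1)"] unit by (simp add: tr inner_diff_right c_def)
  then have "inner Z (M ** dagger M - C ** dagger C) \<le> 1 - c"
    using inner_contraction_le[OF Z, of "M ** S" "M ** S"] by (simp add: MS power2_eq_square)
  also have "\<dots> \<le> 1 - f\<^sup>2" using fc by simp
  finally have 1: "inner Z (M ** dagger M - C ** dagger C) \<le> 1 - f\<^sup>2" .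
  \<comment> \<open>A difference of squares, symmetrised since the factors do not commute.\<close>
  have "C ** dagger C - N ** dagger N =
      (1/2) *\<^sub>R ((C - N) ** dagger (C + N)) + (1/2) *\<^sub>R ((C + N) ** dagger (C - N))"
    by (simp add: dagger_add dagger_diff matrix_add_ldistrib matrix_add_rdistrib matrix_diff_ldistrib
        matrix_diff_rdistrib vec_eq_iff scaleR_right_diff_distrib scaleR_right_distrib
        flip: scaleR_add_left)
  then have 2: "inner Z (C ** dagger C - N ** dagger N) \<le> norm (C - N) * norm (C + N)"
    using inner_contraction_le[OF Z, of "C - N" "C + N"] inner_contraction_le[OF Z, of "C + N" "C - N"]
    by (simp add: inner_add_right mult.commute[of "norm (C + N)"])
  \<comment> \<open>The two squared norms are c + 1 \<mp> 2 \<open>inner N C\<close>, as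
    \<open>N\<close> is a unit vector.\<close>
  have "(norm (C - N) * norm (C + N))\<^sup>2 = (c + 1)\<^sup>2 - (2 * inner N C)\<^sup>2"
    using unit unfolding power_mult_distrib c_def
    by (simp add: power2_norm_eq_inner inner_diff inner_add inner_commute[of C N] norm_eq_1 algebra_simps)
       (simp add: power2_eq_square algebra_simps)
  also have "\<dots> \<le> 4 * (1 - f\<^sup>2)"
  proof -
    have "f\<^sup>2 \<le> (inner N C)\<^sup>2" using f F(2) by (intro power_mono)
    moreover have "(c + 1)\<^sup>2 \<le> 2\<^sup>2" using c1 by (intro power_mono) (simp_all add: c_def)
    ultimately show ?thesis by (simp add: power_mult_distrib)
  qed
  finally have "norm (C - N) * norm (C + N) \<le> sqrt (4 * (1 - f\<^sup>2))"
    by (rule real_le_rsqrt)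
  also have "\<dots> = 2 * sqrt (1 - f\<^sup>2)"
    by (subst real_sqrt_mult) simp
  finally show ?thesis
    using 1 2 by (simp add: inner_diff_right)
qed


section \<open>The masking bound\<close>

definition coeff_matrix :: "complex ^ ('a \<times> 'b) \<Rightarrow> complex ^ 'b ^ 'a" where
  "coeff_matrix v = (\<chi> i j. v $ (i, j))"

lemma norm_coeff_matrix: "norm (coeff_matrix v) = norm v"
  for v :: "complex ^ ('a::finite \<times> 'b::finite)"
proof -
  have "(norm (coeff_matrix v))\<^sup>2 = (norm v)\<^sup>2"
    unfolding power2_norm_eq_inner inner_vec_def coeff_matrix_def
    by (simp add: sum.cartesian_product flip: UNIV_Times_UNIV)
  then show ?thesis by simp
qed

lemma ptrace_B_proj: "ptrace_B (proj v) = coeff_matrix v ** dagger (coeff_matrix v)"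
  by (simp add: ptrace_B_def proj_def coeff_matrix_def dagger_def matrix_matrix_mult_def)

lemma ptrace_A_proj:
  "ptrace_A (proj v) = transpose (coeff_matrix v) ** dagger (transpose (coeff_matrix v))"
  by (simp add: ptrace_A_def proj_def coeff_matrix_def dagger_def matrix_matrix_mult_def transpose_def)

lemma fidelity_transpose_eq_inner_contraction:
  fixes M N :: "complex ^ 's ^ 'r"
  shows "\<exists>Z. contraction Z \<and>
    fidelity (transpose M ** dagger (transpose M)) (transpose N ** dagger (transpose N))
      = inner Z (M ** dagger N)"
proof -
  obtain W where W: "contraction W"
    "fidelity (transpose M ** dagger (transpose M)) (transpose N ** dagger (transpose N))
      = inner (transpose N) (transpose M ** W)"
    using fidelity_eq_inner_contraction by blast
  have tr: "inner (transpose A) (transpose B) = inner A B" for A B :: "complex ^ 's ^ 'l"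
    unfolding inner_vec_def transpose_def by simp (rule sum.swap)
  have "inner (transpose N) (transpose M ** W) = inner N (transpose W ** M)"
    using tr[of N "transpose W ** M"] by (simp add: matrix_transpose_mul)
  also have "\<dots> = inner M (dagger (transpose W) ** N)"
    using inner_mult_right1[of M "dagger (transpose W)" N] by (simp only: dagger_dagger inner_commute)
  also have "\<dots> = inner (M ** dagger N) (dagger (transpose W))"
    by (simp add: inner_mult_right2)
  finally show ?thesis
    using W contraction_dagger[OF contraction_transpose[OF W(1)]] by (metis inner_commute)
qed

lemma fidelity_on_plane_bound:
  fixes u v :: "complex ^ ('a::finite \<times> 'b::finite)" and f :: real
  assumes unit: "norm u = 1" "norm v = 1" and orth: "cinner u v = 0"
    and F: "\<And>x y. norm x = 1 \<Longrightarrow> norm y = 1 \<Longrightarrow>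
      x \<in> {c *s u + d *s v |c d. True} \<Longrightarrow> y \<in> {c *s u + d *s v |c d. True} \<Longrightarrow>
      fidelity (ptrace_B (proj x)) (ptrace_B (proj y)) \<ge> f \<and>
      fidelity (ptrace_A (proj x)) (ptrace_A (proj y)) \<ge> f"
    and f: "f \<ge> 0"
  shows "f \<le> (1 - f\<^sup>2) + 2 * sqrt (1 - f\<^sup>2)"
proof -
  define A where "A = coeff_matrix u"
  define B where "B = coeff_matrix v"
  define X where "X = A ** dagger B"
  define r where "r = complex_of_real (1 / sqrt 2)"
  define k where "k = (1 - f\<^sup>2) + 2 * sqrt (1 - f\<^sup>2)"
  \<comment> \<open>The superposition (u + c v) / sqrt 2, needed for c = 1, -1, \<i>, -\<i>;
    \<open>\<rho> c\<close> is its first marginal.\<close>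
  define x where "x c = r *s u + (r * c) *s v" for c
  define \<rho> where "\<rho> c = coeff_matrix (x c) ** dagger (coeff_matrix (x c))" for c
  have r: "r * r = 1/2" "cnj r = r"
    by (simp_all add: r_def flip: of_real_mult)
  have orth': "cinner v u = 0"
    using orth by (metis cnj_cinner complex_cnj_zero)
  have nx: "norm (x c) = 1" if "cnj c * c = 1" for c
  proof -
    have "cinner (x c) (x c) = r * r + (r * r) * (cnj c * c)"
      by (simp add: x_def cinner_simps orth orth' cinner_self[of u] cinner_self[of v] unit r(2) algebra_simps)
    then have "cinner (x c) (x c) = 1" unfolding r that by simp
    then have "(norm (x c))\<^sup>2 = 1"
      by (metis cinner_self of_real_eq_1_iff)
    then show ?thesis by (simp add: power2_eq_1_iff) (smt (verit) norm_ge_zero)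
  qed
  have span: "x c \<in> {c *s u + d *s v |c d. True}" for c
    by (auto simp: x_def)
  have diff: "inner Z (\<rho> c - \<rho> d) \<le> k" if "cnj c * c = 1" "cnj d * d = 1" "contraction Z" for c d Z
    unfolding \<rho>_def k_def
    using F[OF nx[OF that(1)] nx[OF that(2)] span span] f that(3)
    by (intro inner_marginal_difference_le) (auto simp: norm_coeff_matrix nx that ptrace_B_proj)
  \<comment> \<open>Polarisation: the first difference is X + B A\<dagger>, and \<i> times the
    second is X - B A\<dagger>.\<close>
  have X: "X = (1/2) *\<^sub>R (\<rho> 1 - \<rho> (- 1)) + (1/2) *\<^sub>R (mat \<i> ** (\<rho> \<i> - \<rho> (- \<i>)))"
  proof -
    have \<rho>: "\<rho> c $ i $ j = 1/2 * ((A ** dagger A) $ i $ j + cnj c * X $ i $ j +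
        c * (B ** dagger A) $ i $ j + c * cnj c * (B ** dagger B) $ i $ j)" for c i j
    proof -
      have "\<rho> c $ i $ j = (r * r) * ((A ** dagger A) $ i $ j + cnj c * X $ i $ j +
        c * (B ** dagger A) $ i $ j + c * cnj c * (B ** dagger B) $ i $ j)"
        by (simp add: \<rho>_def x_def X_def A_def B_def coeff_matrix_def dagger_def
            matrix_matrix_mult_def r(2) sum_distrib_left algebra_simps flip: sum.distrib)
      then show ?thesis by (simp only: r(1))
    qed
    have "(mat \<i> ** D) $ i $ j = \<i> * D $ i $ j" for D :: "complex ^ 'a ^ 'a" and i j
      by (simp add: mat_def matrix_matrix_mult_def if_distrib[of "\<lambda>c. c * _"] cong: if_cong)
    then have "(mat \<i> ** (\<rho> \<i> - \<rho> (- \<i>))) $ i $ j = X $ i $ j - (B ** dagger A) $ i $ j" for i j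
      by (simp add: \<rho> field_simps)
    moreover have "(\<rho> 1 - \<rho> (- 1)) $ i $ j = X $ i $ j + (B ** dagger A) $ i $ j" for i j
      by (simp add: \<rho> field_simps)
    ultimately have "(\<rho> 1 - \<rho> (- 1)) + mat \<i> ** (\<rho> \<i> - \<rho> (- \<i>)) = 2 *\<^sub>R X"
      unfolding vec_eq_iff vector_add_component vector_scaleR_component by (simp add: scaleR_2)
    then show ?thesis
      by (simp flip: scaleR_add_right)
  qed
  obtain Z where Z: "contraction Z"
    "fidelity (ptrace_A (proj u)) (ptrace_A (proj v)) = inner Z X"
    using fidelity_transpose_eq_inner_contraction[of A B]
    unfolding ptrace_A_proj A_def B_def X_def by blast
  have "u = 1 *s u + 0 *s v" "v = 0 *s u + 1 *s v" by simp_all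
  then have "f \<le> inner Z X"
    using F[of u v] unit Z(2) by fastforce
  \<comment> \<open>The scalar \<i> moves onto \<open>Z\<close> and leaves a contraction, so both
    pairings are at most \<open>k\<close>.\<close>
  also have "inner Z X = (inner Z (\<rho> 1 - \<rho> (- 1)) + inner (dagger (mat \<i>) ** Z) (\<rho> \<i> - \<rho> (- \<i>))) / 2"
    by (subst X) (simp add: inner_add_right inner_mult_right1)
  also have "\<dots> \<le> k"
    using diff[of 1 "- 1" Z] diff[of \<i> "- \<i>" "dagger (mat \<i>) ** Z"] Z(1)
      contraction_mult[OF contraction_dagger[OF contraction_mat_i] Z(1)]
    by simp
  finally show ?thesis by (simp add: k_def)
qed

text \<open>Gram-Schmidt in the image, carried out on preimages because \<open>T\<close> need not be
  isometric.\<close>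

lemma orthonormal_pair_in_injective_image:
  fixes T :: "complex ^ 'a::finite \<Rightarrow> complex ^ 'k::finite"
  assumes card: "CARD('a) \<ge> 2"
    and add: "\<And>x y. T (x + y) = T x + T y" and scale: "\<And>c x. T (c *s x) = c *s T x"
    and inj: "\<And>x. T x = 0 \<Longrightarrow> x = 0"
  shows "\<exists>x y. norm (T x) = 1 \<and> norm (T y) = 1 \<and> cinner (T x) (T y) = 0"
proof -
  have normalise: "\<exists>y c. norm (T y) = 1 \<and> y = complex_of_real c *s x" if x: "x \<noteq> 0" for x
  proof -
    have "T x \<noteq> 0" using inj x by blast
    then have "norm (T (complex_of_real (1 / norm (T x)) *s x)) = 1"
      unfolding scale by (simp del: of_real_divide flip: scaleR_eq_vector_scalar_mult)
    then show ?thesis by blast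
  qed
  obtain i j :: 'a where ij: "i \<noteq> j"
    using card card_le_Suc0_iff_eq[of "UNIV :: 'a set"] by force
  define e where "e = (axis i 1 :: complex ^ 'a)"
  define g where "g = (axis j 1 :: complex ^ 'a)"
  have "e \<noteq> 0" by (simp add: e_def axis_eq_0_iff)
  then obtain x c where x: "norm (T x) = 1" "x = complex_of_real c *s e"
    using normalise by blast
  have diff: "T (v - w) = T v - T w" for v w
    using add[of "v - w" w] by simp
  define z where "z = g - cinner (T x) (T g) *s x"
  \<comment> \<open>As \<open>x\<close> is a multiple of the other basis vector \<open>e\<close>,
    subtracting it leaves coordinate \<open>j\<close> of \<open>g\<close> unchanged.\<close>
  have "z $ j = 1"
    using ij by (simp add: z_def x(2) e_def g_def axis_def)
  then have "z \<noteq> 0" by auto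
  then obtain y d where y: "norm (T y) = 1" "y = complex_of_real d *s z"
    using normalise by blast
  have "cinner (T x) (T z) = 0"
    by (simp add: z_def diff scale cinner_simps cinner_self x(1))
  then have "cinner (T x) (T y) = 0"
    by (simp add: y(2) scale cinner_simps)
  then show ?thesis using x(1) y(1) by blast
qed

lemma tensor_eq_0_imp:
  assumes "a \<otimes> b = 0" "b \<noteq> 0"
  shows "a = 0"
proof -
  obtain j where "b $ j \<noteq> 0"
    using assms(2) by (auto simp: vec_eq_iff)
  moreover have "a $ i * b $ j = 0" for i
    using arg_cong[OF assms(1), of "\<lambda>v. v $ (i, j)"] by (simp add: tensor_def)
  ultimately show ?thesis by (simp add: vec_eq_iff)
qed

theorem theorem4:
  fixes \<epsilon> :: real
  assumes "CARD('a::finite) \<ge> 2" and "CARD('b::finite) \<ge> 2"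
    and "\<exists>(L :: complex ^ ('a \<times> 'b) ^ ('a \<times> 'b)) (b :: complex ^ 'b).
           approx_prob_masker \<epsilon> (pure_states :: (complex ^ 'a) set) L b"
  shows "\<epsilon> \<ge> sqrt 2 / 72 * (- 1 + sqrt (1 + 36 / real (min CARD('a) CARD('b))))"
proof -
  obtain L :: "complex ^ ('a \<times> 'b) ^ ('a \<times> 'b)" and b :: "complex ^ 'b"
    where masker: "approx_prob_masker \<epsilon> (pure_states :: (complex ^ 'a) set) L b"
    using assms(3) by blast
  then have b: "norm b = 1" and L: "invertible L"
    unfolding approx_prob_masker_def by (auto simp: pure_states_def)
  obtain p \<Psi> where \<Psi>: "\<And>a :: complex ^ 'a. norm a = 1 \<Longrightarrow> 0 < (p a :: real) \<and> norm (\<Psi> a) = 1 \<and> L *v (a \<otimes> b) = p a *\<^sub>R \<Psi> a"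
      and F: "\<And>a a' :: complex ^ 'a. norm a = 1 \<Longrightarrow> norm a' = 1 \<Longrightarrow>
        fidelity (ptrace_B (proj (\<Psi> a))) (ptrace_B (proj (\<Psi> a'))) \<ge> 1 - \<epsilon> \<and>
        fidelity (ptrace_A (proj (\<Psi> a))) (ptrace_A (proj (\<Psi> a'))) \<ge> 1 - \<epsilon>"
    using masker unfolding approx_prob_masker_def pure_states_def mem_Collect_eq by blast
  \<comment> \<open>Unlike the normalised states \<open>\<Psi> a\<close>, the vectors
    \<open>T a\<close> depend linearly on \<open>a\<close>.\<close>
  define T where "T a = L *v (a \<otimes> b)" for a
  have tensor: "(x + y) \<otimes> b = x \<otimes> b + y \<otimes> b" "(c *s x) \<otimes> b = c *s (x \<otimes> b)" for x y :: "complex ^ 'a" and c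
    by (simp_all add: tensor_def vec_eq_iff algebra_simps)
  have add: "T (x + y) = T x + T y" and scale: "T (c *s x) = c *s T x" for x y c
    by (simp_all add: T_def tensor matrix_vector_right_distrib vector_scalar_commute)
  have inj: "x = 0" if "T x = 0" for x
  proof -
    have "x \<otimes> b = 0"
      using that L unfolding T_def by (metis invertible_def matrix_left_invertible_ker)
    then show ?thesis using tensor_eq_0_imp b by fastforce
  qed
  have range: "\<exists>a. norm a = 1 \<and> T x = \<Psi> a" if "norm (T x) = 1" for x
  proof -
    have "x \<noteq> 0" using that scale[of 0 x] by auto
    define a where "a = complex_of_real (1 / norm x) *s x"
    have a: "norm a = 1"
      using \<open>x \<noteq> 0\<close> by (simp add: a_def del: of_real_divide flip: scaleR_eq_vector_scalar_mult)
    have "T x = norm x *\<^sub>R T a"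
      using \<open>x \<noteq> 0\<close> by (simp add: a_def scale scaleR_eq_vector_scalar_mult)
    also have "\<dots> = (norm x * p a) *\<^sub>R \<Psi> a"
      using \<Psi>[OF a] by (simp add: T_def)
    finally have Tx: "T x = (norm x * p a) *\<^sub>R \<Psi> a" .
    \<comment> \<open>The scalar is positive and both vectors have norm 1, so neither a factor nor a
      phase remains.\<close>
    then have "norm x * p a = 1"
      using that \<Psi>[OF a] by simp
    then show ?thesis using a Tx by auto
  qed
  obtain x y where xy: "norm (T x) = 1" "norm (T y) = 1" "cinner (T x) (T y) = 0"
    using orthonormal_pair_in_injective_image[of T] assms(1) add scale inj by blast
  have plane: "\<exists>a. norm a = 1 \<and> z = \<Psi> a" if "z \<in> {c *s T x + d *s T y |c d. True}" "norm z = 1" for z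
    using that range by (auto simp flip: scale add)
  have "\<epsilon> > 7/100"
  proof (rule ccontr)
    assume small: "\<not> \<epsilon> > 7/100"
    define f :: real where "f = 93/100"
    have "f \<le> (1 - f\<^sup>2) + 2 * sqrt (1 - f\<^sup>2)"
    proof (rule fidelity_on_plane_bound[OF xy])
      fix z w assume z: "norm z = 1" "norm w = 1"
        "z \<in> {c *s T x + d *s T y |c d. True}" "w \<in> {c *s T x + d *s T y |c d. True}"
      obtain a where "norm a = 1" "z = \<Psi> a" using plane[OF z(3,1)] by blast
      moreover obtain a' where "norm a' = 1" "w = \<Psi> a'" using plane[OF z(4,2)] by blast
      ultimately show "fidelity (ptrace_B (proj z)) (ptrace_B (proj w)) \<ge> f \<and>
          fidelity (ptrace_A (proj z)) (ptrace_A (proj w)) \<ge> f"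
        using F[of a a'] small by (auto simp: f_def)
    qed (simp add: f_def)
    moreover have "sqrt (1 - f\<^sup>2) \<le> 37/100"
      by (rule real_le_lsqrt) (simp_all add: f_def power2_eq_square)
    ultimately show False
      by (simp add: f_def power2_eq_square)
  qed
  \<comment> \<open>The expression is largest when the minimum is 2, where it is at most 1.415 * 3.4
    / 72 < 0.067.\<close>
  moreover have "sqrt 2 / 72 * (- 1 + sqrt (1 + 36 / real (min CARD('a) CARD('b)))) \<le> 7/100"
  proof -
    have "36 / real (min CARD('a) CARD('b)) \<le> 36 / 2"
      using assms(1,2) by (intro divide_left_mono) auto
    then have "sqrt (1 + 36 / real (min CARD('a) CARD('b))) \<le> sqrt 19"
      by simp
    also have "\<dots> \<le> 44/10"
      by (rule real_le_lsqrt) (simp_all add: power2_eq_square)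
    finally have "- 1 + sqrt (1 + 36 / real (min CARD('a) CARD('b))) \<le> 34/10" by simp
    moreover have "sqrt 2 \<le> 1415/1000"
      by (rule real_le_lsqrt) (simp_all add: power2_eq_square)
    ultimately have "sqrt 2 * (- 1 + sqrt (1 + 36 / real (min CARD('a) CARD('b)))) \<le> 1415/1000 * (34/10)"
      by (intro mult_mono) auto
    then show ?thesis by simp
  qed
  ultimately show ?thesis by linarith
qed

end
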